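(* Let $X,Z$ be normed spaces, $\Omega\subset X$, $f:\Omega\to\mathbb{R}$ and $g:\Omega\to Z$ functions, and $U\subset Z$ an open neighborhood of $0_Z$ such that for every $z\in U$ there is $x\in\Omega$ with $g(x)=z$. Let $$r_0:=\inf\{f(x):x\in\Omega,\ g(x)=0_Z\}.$$ Assume that $r_0\in\mathbb{R}$ and that there exists a lower semicontinuous sublinear mapping $\varphi:Z\to\mathbb{R}$ satisfying $$-\varphi(g(x))<f(x)-r_0\quad\text{for all }x\in\Omega\text{ with }g(x)\neq0_Z.$$ Then $$r_0=\inf\{f(x)+\varphi(g(x)):x\in\Omega\}.$$ Moreover, if $r_0=f(x_0)$ for some $x_0\in\Omega$ with $g(x_0)=0_Z$, then $x_0$ also minimizes $f(x)+\varphi(g(x))$ over $x\in\Omega$, and $\varphi(g(x_0))=0$.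
   Context: All normed spaces are real. $\varphi:Z\to\mathbb{R}$ is sublinear if $\varphi(\lambda x)=\lambda\varphi(x)$ and $\varphi(x+y)\le\varphi(x)+\varphi(y)$ for all $x,y\in Z$, $\lambda\ge0$. *)

theory Defs
  imports "HOL-Analysis.Analysis"
begin

definition sublinear :: "('a::real_vector \<Rightarrow> real) \<Rightarrow> bool" where
  "sublinear \<phi> \<longleftrightarrow>
     (\<forall>c\<ge>0. \<forall>x. \<phi> (c *\<^sub>R x) = c * \<phi> x) \<and> (\<forall>x y. \<phi> (x + y) \<le> \<phi> x + \<phi> y)"

definition lower_semicontinuous :: "('a::topological_space \<Rightarrow> real) \<Rightarrow> bool" where
  "lower_semicontinuous \<phi> \<longleftrightarrow> (\<forall>x. \<forall>a<\<phi> x. \<forall>\<^sub>F y in nhds x. a < \<phi> y)"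

end

theory Submission
  imports Defs
begin

text \<open>The term \<open>\<phi> (g x)\<close> acts as an exact penalty for the constraint
  \<open>g x = 0\<close>. Since \<open>\<phi> 0 = 0\<close>, it vanishes at feasible points, so
  passing to all of \<Omega> cannot raise the infimum above \<open>r0\<close>. Conversely,
  \<open>r0\<close> bounds \<open>f x + \<phi> (g x)\<close> from below: at feasible points by
  definition of \<open>r0\<close>, elsewhere by rearranging the assumed inequality
  (\<open>lower\<close>).\<close>

lemma sublinear_zero: "\<phi> 0 = 0" if "sublinear \<phi>"
proof -
  have "\<phi> (0 *\<^sub>R 0) = 0 * \<phi> 0"
    using that unfolding sublinear_def by blast
  then show ?thesis by simp
qed

theorem theorem3p14:
  fixes \<Omega> :: "'x::real_normed_vector set"
    and f :: "'x \<Rightarrow> real"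
    and g :: "'x \<Rightarrow> 'z::real_normed_vector"
    and U :: "'z set"
    and r0 :: real
    and \<phi> :: "'z \<Rightarrow> real"
  assumes "open U" and "0 \<in> U"
    and "\<And>z. z \<in> U \<Longrightarrow> \<exists>x\<in>\<Omega>. g x = z"
    and "ereal r0 = (INF x\<in>{x\<in>\<Omega>. g x = 0}. ereal (f x))"
    and "lower_semicontinuous \<phi>" and "sublinear \<phi>"
    and "\<And>x. x \<in> \<Omega> \<Longrightarrow> g x \<noteq> 0 \<Longrightarrow> - \<phi> (g x) < f x - r0"
  shows "ereal r0 = (INF x\<in>\<Omega>. ereal (f x + \<phi> (g x)))
    \<and> (\<forall>x0\<in>\<Omega>. g x0 = 0 \<and> r0 = f x0 \<longrightarrow>
          is_arg_min (\<lambda>x. f x + \<phi> (g x)) (\<lambda>x. x \<in> \<Omega>) x0 \<and> \<phi> (g x0) = 0)"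
proof -
  have \<phi>0: "\<phi> 0 = 0"
    using assms(6) by (rule sublinear_zero)
  have lower: "r0 \<le> f x + \<phi> (g x)" if "x \<in> \<Omega>" for x
  proof (cases "g x = 0")
    case True
    have "ereal r0 \<le> ereal (f x)"
      unfolding assms(4) using that True by (intro INF_lower) auto
    then show ?thesis using True \<phi>0 by simp
  next
    case False
    then show ?thesis using assms(7)[OF that] by simp
  qed
  have "ereal r0 = (INF x\<in>\<Omega>. ereal (f x + \<phi> (g x)))"
  proof (rule antisym)
    show "ereal r0 \<le> (INF x\<in>\<Omega>. ereal (f x + \<phi> (g x)))"
      using lower by (intro INF_greatest) simp
    \<comment> \<open>With \<open>r0\<close> expanded as the constrained infimum, \<Omega> contains
      the feasible set and both objectives agree there.\<close>
    show "(INF x\<in>\<Omega>. ereal (f x + \<phi> (g x))) \<le> ereal r0"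
      unfolding assms(4) by (rule INF_superset_mono) (auto simp: \<phi>0)
  qed
  moreover have "is_arg_min (\<lambda>x. f x + \<phi> (g x)) (\<lambda>x. x \<in> \<Omega>) x0 \<and> \<phi> (g x0) = 0"
    if "x0 \<in> \<Omega>" "g x0 = 0" "r0 = f x0" for x0
    \<comment> \<open>At \<open>x0\<close> the penalized objective equals \<open>f x0 = r0\<close>,
      so the lower bound is attained.\<close>
    using that lower \<phi>0 by (auto simp: is_arg_min_linorder)
  ultimately show ?thesis by blast
qed

end
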